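(* Let $V\subset\mathbb{R}^2$ be a star, i.e. the union of rays $V_l$, $1\le l\le M$, with a common apex, where $V_l$ is spanned by the vector $(p_l,q_l)$ and for each $1\le l\le M$ either $p_l,q_l$ are relatively prime integers, or $p_l,q_l$ are integers with $p_lq_l=0$, $|p_l|+|q_l|=1$. Then the limit $$\deg T^{(\Box)}(V):=\lim_{k\to\infty}\frac{TH_V^{(\Box)}(k)}{k}$$ exists and $$\deg T^{(\Box)}(V)=\max\Bigl\{\sum_{p_l>0}p_l,\ -\sum_{p_l<0}p_l\Bigr\}+\max\Bigl\{\sum_{q_l>0}q_l,\ -\sum_{q_l<0}q_l\Bigr\}.$$
   Context: The rays $V_1,\dots,V_M$ are pairwise distinct, each of the form $\{v_0+z(p_l,q_l)\mid z\ge 0\}$ with $v_0\in\mathbb{R}^2$ the common apex. Tropical polynomials $f_1,\dots,f_m$ (functions that are minima of finitely many functions $a_1x_1+\cdots+a_nx_n+a_0$ with $a_1,\dots,a_n\in\mathbb{Z}_{\ge0}$, $a_0\in\mathbb{R}$) are tropically independent on $V\subset\mathbb{R}^n$ if there exist $b_1,\dots,b_m\in\mathbb{R}$ and $v_1,\dots,v_m\in V$ such that $b_{j_0}+f_{j_0}(v_{j_0})<b_j+f_j(v_{j_0})$ for all $1\le j\ne j_0\le m$. The modified tropical Hilbert function $TH_V^{(\Box)}(k)$ is the maximal number of elements of a subset, tropically independent on $V$, of the set of tropical monomials $\{i_1x_1+\cdots+i_nx_n\mid i_j\in\mathbb{Z},\ 0\le i_j\le k,\ 1\le j\le n\}$ (here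 $n=2$). *)

theory Defs
  imports "HOL-Analysis.Analysis"
begin

text \<open>The family \<open>f\<close> is indexed by an arbitrary set \<open>J\<close>. The condition makes sense for
  arbitrary functions; below it is applied to tropical monomials. The empty family is
  independent on every \<open>V\<close>.\<close>

definition tropically_independent_on ::
    "(real^'n) set \<Rightarrow> 'i set \<Rightarrow> ('i \<Rightarrow> real^'n \<Rightarrow> real) \<Rightarrow> bool"
  where "tropically_independent_on V J f \<longleftrightarrow>
    (\<exists>(b :: 'i \<Rightarrow> real) (v :: 'i \<Rightarrow> real^'n).
      (\<forall>j\<in>J. v j \<in> V) \<and>
      (\<forall>j0\<in>J. \<forall>j\<in>J. j \<noteq> j0 \<longrightarrow> b j0 + f j0 (v j0) < b j + f j (v j0)))"

definition trop_monomial :: "('n::finite \<Rightarrow> int) \<Rightarrow> real^'n \<Rightarrow> real"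
  where "trop_monomial i = (\<lambda>x. \<Sum>j\<in>UNIV. of_int (i j) * x $ j)"

definition box_monomials :: "nat \<Rightarrow> (real^'n::finite \<Rightarrow> real) set"
  where "box_monomials k = {trop_monomial i | i. \<forall>j. 0 \<le> i j \<and> i j \<le> int k}"

text \<open>A set \<open>S\<close> of functions is viewed as the family indexed by itself.\<close>

definition TH_box :: "(real^'n::finite) set \<Rightarrow> nat \<Rightarrow> nat"
  where "TH_box V k =
    Max {card S | S. S \<subseteq> box_monomials k \<and> tropically_independent_on V S (\<lambda>f. f)}"

definition degT_box :: "(real^'n::finite) set \<Rightarrow> real"
  where "degT_box V = lim (\<lambda>k. real (TH_box V k) / real k)"

definition ray :: "real^2 \<Rightarrow> int \<Rightarrow> int \<Rightarrow> (real^2) set"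
  where "ray v0 p q = {v0 + z *\<^sub>R vector [of_int p, of_int q] | z. z \<ge> 0}"

text \<open>The maximum in \<open>TH_box\<close> is taken over a finite nonempty set.\<close>

lemma finite_box_monomials: "finite (box_monomials k :: (real^'n::finite \<Rightarrow> real) set)"
proof -
  have "box_monomials k = trop_monomial ` (PiE (UNIV::'n set) (\<lambda>_. {0..int k}))"
    by (auto simp: box_monomials_def PiE_def Pi_def extensional_def)
  then show ?thesis
    by (simp add: finite_PiE)
qed

lemma TH_box_candidates:
  fixes V :: "(real^'n::finite) set" and k :: nat
  defines "C \<equiv> {card S | S. S \<subseteq> box_monomials k \<and> tropically_independent_on V S (\<lambda>f. f)}"
  shows "finite C" and "C \<noteq> {}"
proof -
  have "C \<subseteq> card ` Pow (box_monomials k :: (real^'n \<Rightarrow> real) set)"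
    by (auto simp: C_def)
  then show "finite C"
    by (rule finite_subset) (simp add: finite_box_monomials)
  have "card ({} :: (real^'n \<Rightarrow> real) set) \<in> C"
    unfolding C_def by (rule CollectI, rule exI[of _ "{}"]) (simp add: tropically_independent_on_def)
  then show "C \<noteq> {}" by blast
qed

end

theory Submission
  imports Defs
begin

text \<open>
  Both bounds \<open>k D - O(1) \<le> TH(k) \<le> k D + O(1)\<close>, with \<open>D\<close> the asserted degree, hold.

  Upper bound (\<open>TH_box_star_le\<close>). A tropical polynomial is concave along each ray, so its slopes
  decrease from the apex outwards, and the number of its monomials visible on a ray is at most the drop of
  the slope, plus one. All rays start with the same monomial, one which is minimal at the apex. If its
  exponents are \<open>(x, y)\<close>, the total drop is \<open>x \<Sum>p\<^sub>l + y \<Sum>q\<^sub>l\<close> minus the least slopes, which is largest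
  when \<open>(x, y)\<close> is a corner of the box, and there it equals \<open>k D\<close>.

  Lower bound (\<open>TH_box_star_ge\<close>). Every ray has to see almost all of its integer slopes, and
  monomials made for different rays must be distinct and must not obstruct each other. Interference is
  controlled by adding the monomials one at a time, each with a constant term so large that it matters
  only very far from the apex. There only slopes count, so a new monomial merely needs a smaller slope on
  one ray than all its predecessors (\<open>record_set_tropically_independent\<close>). This leaves a problem about
  lattice points: list about \<open>k D\<close> points of the box so that each sets a record for one of the linear
  functionals given by the rays. A record for one ray usually raises the values for other rays as
  well, thereby wasting possible records there. The remedy is to let the listed points grow like a
  convex polygon with one long edge for each ray: a lattice point just outside the middle of an edge exceeds
  only the functional of that edge (\<open>polygonal_template\<close>). Sweeping such a polygon by unit steps through the box,
  first horizontally and then vertically, uses up every value of every functional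
  (\<open>record_set_sweep\<close>, \<open>large_record_set_in_box\<close>), except in a margin of constant width.
\<close>

section \<open>Record sets of integer functionals\<close>

text \<open>A set is a record set if its elements can be listed so that each newcomer sets a strict record for
  some functional of the family: it beats everything listed before. This is the combinatorial shadow
  of tropical independence on a union of rays: far out on a ray the monomial of least slope wins, so
  with \<open>h\<close> the negated slope, a newcomer with a record for \<open>h\<close> can be made the unique minimum far out
  on that ray, whatever else is present.\<close>

inductive record_set :: "('a \<Rightarrow> int) set \<Rightarrow> 'a set \<Rightarrow> bool" for H where
  empty: "record_set H {}"
| insert: "record_set H S \<Longrightarrow> h \<in> H \<Longrightarrow> (\<And>s. s \<in> S \<Longrightarrow> h s < h x) \<Longrightarrow> record_set H (insert x S)"

lemma record_set_finite: "record_set H S \<Longrightarrow> finite S"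
  by (induction rule: record_set.induct) auto

lemma record_set_chain:
  assumes "record_set H S" "h \<in> H" "\<And>s. s \<in> S \<Longrightarrow> h s \<le> t"
    and "\<And>i. i \<in> {1..int n} \<Longrightarrow> h (y i) = t + i"
  shows "record_set H (S \<union> y ` {1..int n}) \<and> card (S \<union> y ` {1..int n}) = card S + n"
  using assms(4)
proof (induction n)
  case 0
  then show ?case using assms by simp
next
  case (Suc n)
  let ?S = "S \<union> y ` {1..int n}"
  have IH: "record_set H ?S" "card ?S = card S + n"
    using Suc by auto
  have less: "h s < h (y (int (Suc n)))" if "s \<in> ?S" for s
    using that Suc.prems assms(3) by fastforce
  have "{1..int (Suc n)} = insert (int (Suc n)) {1..int n}" by auto
  then have eq: "S \<union> y ` {1..int (Suc n)} = insert (y (int (Suc n))) ?S" by auto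
  have "y (int (Suc n)) \<notin> ?S" using less by blast
  then show ?case
    unfolding eq using record_set.insert[OF IH(1) assms(2) less] IH(2) record_set_finite[OF IH(1)]
    by (auto simp del: of_nat_Suc)
qed

text \<open>The threshold \<open>T l\<close> bounds the values of \<open>h l\<close> so far. The points for \<open>l\<close> take the next \<open>p l\<close> values
  above it, without exceeding the thresholds of the other functionals; hence the groups of points do
  not spoil each other's records and can be added one after the other.\<close>

lemma record_set_layer:
  assumes "finite L" "record_set H S" "\<And>l. l \<in> L \<Longrightarrow> h l \<in> H" "\<And>l. l \<in> L \<Longrightarrow> 0 < p l"
    and start: "\<And>l s. l \<in> L \<Longrightarrow> s \<in> S \<Longrightarrow> h l s \<le> T l"
    and own: "\<And>l i. l \<in> L \<Longrightarrow> i \<in> {1..p l} \<Longrightarrow> h l (y l i) = T l + i"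
    and other: "\<And>l i l'. l \<in> L \<Longrightarrow> i \<in> {1..p l} \<Longrightarrow> l' \<in> L \<Longrightarrow> l' \<noteq> l \<Longrightarrow> h l' (y l i) \<le> T l'"
  shows "record_set H (S \<union> (\<Union>l\<in>L. y l ` {1..p l})) \<and>
    int (card (S \<union> (\<Union>l\<in>L. y l ` {1..p l}))) = int (card S) + sum p L"
proof -
  have "record_set H (S \<union> (\<Union>l\<in>F. y l ` {1..p l})) \<and>
    int (card (S \<union> (\<Union>l\<in>F. y l ` {1..p l}))) = int (card S) + sum p F" if "F \<subseteq> L" for F
    using finite_subset[OF that assms(1)] that
  proof (induction F rule: finite_induct)
    case empty
    then show ?case using assms by simp
  next
    case (insert l F)
    let ?S = "S \<union> (\<Union>l\<in>F. y l ` {1..p l})"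
    have IH: "record_set H ?S" "int (card ?S) = int (card S) + sum p F"
      using insert by auto
    have l: "l \<in> L" "int (nat (p l)) = p l" using insert assms(4)[of l] by auto
    have le: "h l s \<le> T l" if "s \<in> ?S" for s
      using that start[OF l(1)] other[OF _ _ l(1)] insert.hyps(2) insert.prems by blast
    have "record_set H (?S \<union> y l ` {1..p l}) \<and> card (?S \<union> y l ` {1..p l}) = card ?S + nat (p l)"
      using record_set_chain[OF IH(1) assms(3)[OF l(1)] le, of "nat (p l)" "y l"] own[OF l(1)] l(2)
      by simp
    moreover have "S \<union> (\<Union>l\<in>insert l F. y l ` {1..p l}) = ?S \<union> y l ` {1..p l}" by auto
    ultimately show ?case using IH(2) l(2) insert.hyps by simp
  qed
  then show ?thesis by blast
qed

text \<open>Translating a layer by one step along a coordinate axis raises the functional \<open>h l\<close> by \<open>p l\<close>, which is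
  exactly the number of values that the points for \<open>l\<close> consume in one layer. So the layers fit on top of
  each other without gaps or overlaps, and each of them contributes \<open>\<Sum>l\<in>L. p l\<close> new points.\<close>

lemma record_set_sweep:
  assumes "finite L" "record_set H S" "\<And>l. l \<in> L \<Longrightarrow> h l \<in> H" "\<And>l. l \<in> L \<Longrightarrow> 0 < p l"
    and start: "\<And>l s. l \<in> L \<Longrightarrow> s \<in> S \<Longrightarrow> h l s \<le> T l"
    and own: "\<And>l i a. l \<in> L \<Longrightarrow> i \<in> {1..p l} \<Longrightarrow> h l (y a l i) = T l + p l * int a + i"
    and other: "\<And>l i l' a. l \<in> L \<Longrightarrow> i \<in> {1..p l} \<Longrightarrow> l' \<in> L \<Longrightarrow> l' \<noteq> l \<Longrightarrow>
      h l' (y a l i) \<le> T l' + p l' * int a"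
  shows "record_set H (S \<union> (\<Union>a<n. \<Union>l\<in>L. y a l ` {1..p l})) \<and>
    int (card (S \<union> (\<Union>a<n. \<Union>l\<in>L. y a l ` {1..p l}))) = int (card S) + int n * sum p L"
proof (induction n)
  case 0
  then show ?case using assms by simp
next
  case (Suc n)
  let ?S = "S \<union> (\<Union>a<n. \<Union>l\<in>L. y a l ` {1..p l})"
  have le: "h l s \<le> T l + p l * int n" if l: "l \<in> L" and s_in: "s \<in> ?S" for l s
  proof (cases "s \<in> S")
    case True
    then show ?thesis using start[OF l True] assms(4)[OF l]
      by (smt (verit) mult_nonneg_nonneg of_nat_0_le_iff)
  next
    \<comment> \<open>No functional exceeds on layer \<open>a\<close> its threshold reached at the end of that layer.\<close>
    case False
    then obtain a l' i where s: "a < n" "l' \<in> L" "i \<in> {1..p l'}" "s = y a l' i"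
      using s_in by auto
    have "h l s \<le> T l + p l * (int a + 1)"
      using own[OF l, of i a] other[OF s(2,3) l, of a] s assms(4)[OF l]
      by (cases "l' = l") (auto simp: distrib_left)
    also have "p l * (int a + 1) \<le> p l * int n"
      using s(1) assms(4)[OF l] by (intro mult_left_mono) auto
    finally show ?thesis by simp
  qed
  have "S \<union> (\<Union>a<Suc n. \<Union>l\<in>L. y a l ` {1..p l}) = ?S \<union> (\<Union>l\<in>L. y n l ` {1..p l})"
    by (auto simp: lessThan_Suc)
  moreover have "record_set H (?S \<union> (\<Union>l\<in>L. y n l ` {1..p l})) \<and>
    int (card (?S \<union> (\<Union>l\<in>L. y n l ` {1..p l}))) = int (card ?S) + sum p L"
    by (rule record_set_layer[where h = h and T = "\<lambda>l. T l + p l * int n"])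
      (use assms(1,3,4) Suc le own other in auto)
  ultimately show ?case using Suc by (simp add: distrib_right)
qed

section \<open>A polygonal template\<close>

lemma finite_family_bounded:
  assumes "finite A"
  shows "\<exists>K::int. \<forall>a\<in>A. \<bar>f a\<bar> \<le> K"
proof -
  have "\<forall>a\<in>A. \<bar>f a\<bar> \<le> (\<Sum>a\<in>A. \<bar>f a\<bar>)"
    using assms by (auto intro: member_le_sum)
  then show ?thesis by blast
qed

lemma primitive_eq_if_parallel:
  fixes p q p' q' :: int
  assumes "coprime p q" "coprime p' q'" "0 < p" "0 < p'" "q * p' = q' * p"
  shows "p = p' \<and> q = q'"
proof -
  have "p dvd p' * q" "p' dvd p * q'"
    using assms(5) by (metis dvd_triv_right mult.commute)+
  then have "p dvd p'" "p' dvd p"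
    using assms(1,2) by (auto simp: coprime_dvd_mult_left_iff)
  then have "p = p'" using assms(3,4) by (simp add: zdvd_antisym_nonneg)
  then show ?thesis using assms by simp
qed

text \<open>The points of one layer, for the functionals \<open>h l (x, y) = p l * x + q l * y\<close>. Take a
  large convex polygonal chain with one edge orthogonal to each \<open>(p l, q l)\<close>; just outside
  the middle of an edge there are lattice points on each of the next parallel
  lattice lines, and they lie well inside the half-planes of the other edges.

  To stay within the integers, the edges are placed along a parabola: the point
  \<open>N (- e\<^sup>2, 2 D e)\<close> of the curve has normal direction proportional to \<open>(D, e)\<close>, and this is
  \<open>(p l, q l)\<close> up to scaling for \<open>e = D q l / p l\<close>. The numbers \<open>e l\<close> are distinct because the directions
  are, so the other edges are missed by a margin proportional to the scale \<open>N\<close>. The points of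
  \<open>h l\<close>-value \<open>T l + i\<close> then come from a Bezout vector \<open>(\<alpha> l, \<beta> l)\<close>, and \<open>N\<close> is chosen to
  absorb this bounded displacement.\<close>

lemma polygonal_template:
  fixes p q :: "'l \<Rightarrow> int"
  assumes fin: "finite L" and cop: "\<And>l. l \<in> L \<Longrightarrow> coprime (p l) (q l)"
    and pos: "\<And>l. l \<in> L \<Longrightarrow> 0 < p l" and inj: "inj_on (\<lambda>l. (p l, q l)) L"
  obtains X Y :: "'l \<Rightarrow> int \<Rightarrow> int" and T :: "'l \<Rightarrow> int" and C :: int where
    "0 \<le> C"
    "\<And>l i. l \<in> L \<Longrightarrow> i \<in> {1..p l} \<Longrightarrow> X l i \<in> {0..C} \<and> Y l i \<in> {0..C}"
    "\<And>l i. l \<in> L \<Longrightarrow> i \<in> {1..p l} \<Longrightarrow> p l * X l i + q l * Y l i = T l + i"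
    "\<And>l i l'. l \<in> L \<Longrightarrow> i \<in> {1..p l} \<Longrightarrow> l' \<in> L \<Longrightarrow> l' \<noteq> l \<Longrightarrow>
      p l' * X l i + q l' * Y l i \<le> T l'"
proof -
  define D where "D = (\<Prod>l\<in>L. p l)"
  define e where "e l = q l * (\<Prod>l'\<in>L - {l}. p l')" for l
  have D: "q l * D = p l * e l" if "l \<in> L" for l
    unfolding D_def e_def using that fin by (simp add: prod.remove)
  have Dpos: "D > 0" unfolding D_def using pos by (simp add: prod_pos)
  have e_inj: "l = l'" if l: "l \<in> L" "l' \<in> L" "e l = e l'" for l l'
  proof -
    have "(q l * p l') * D = (q l' * p l) * D"
      using D[OF l(1)] D[OF l(2)] l(3) by (metis mult.commute mult.left_commute)
    then have "q l * p l' = q l' * p l" using Dpos by simp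
    then show ?thesis
      using primitive_eq_if_parallel[of "p l" "q l" "p l'" "q l'"] cop pos inj l(1,2)
      by (auto simp: inj_on_def)
  qed
  have "\<forall>l\<in>L. \<exists>ab. p l * fst ab + q l * snd ab = 1"
  proof
    fix l assume "l \<in> L"
    then obtain u v where "u * p l + v * q l = 1"
      using bezout_int[of "p l" "q l"] cop by (auto simp: coprime_iff_gcd_eq_1)
    then show "\<exists>ab. p l * fst ab + q l * snd ab = 1"
      by (intro exI[of _ "(u, v)"]) (simp add: mult.commute)
  qed
  then obtain ab where "\<forall>l\<in>L. p l * fst (ab l) + q l * snd (ab l) = 1"
    by (rule bchoice[THEN exE])
  moreover define \<alpha> \<beta> where "\<alpha> l = fst (ab l)" and "\<beta> l = snd (ab l)" for l
  ultimately have bez: "p l * \<alpha> l + q l * \<beta> l = 1" if "l \<in> L" for l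
    using that by simp
  obtain N where N: "\<And>l l' i. l \<in> L \<Longrightarrow> l' \<in> L \<Longrightarrow> i \<in> {1..p l} \<Longrightarrow>
      \<bar>i * (p l' * \<alpha> l + q l' * \<beta> l)\<bar> \<le> N"
    using finite_family_bounded[of "SIGMA l:L. SIGMA l':L. {1..p l}"
        "\<lambda>(l, l', i). i * (p l' * \<alpha> l + q l' * \<beta> l)"] fin by fastforce
  define X0 Y0 where "X0 l i = - N * (e l)\<^sup>2 + i * \<alpha> l" and "Y0 l i = 2 * N * D * e l + i * \<beta> l" for l i
  \<comment> \<open>Completing the square: the parabola point for \<open>l\<close> falls short of the maximum of \<open>h l'\<close> by
    \<open>N p l' (e l - e l')\<^sup>2\<close>.\<close>
  have gap: "p l' * X0 l i + q l' * Y0 l i =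
      N * p l' * ((e l')\<^sup>2 - (e l - e l')\<^sup>2) + i * (p l' * \<alpha> l + q l' * \<beta> l)" if "l' \<in> L" for l l' i
  proof -
    have "q l' * (2 * N * D * e l) = 2 * N * e l * (q l' * D)" by (simp add: algebra_simps)
    then show ?thesis unfolding X0_def Y0_def distrib_left D[OF that]
      by (simp add: algebra_simps power2_eq_square)
  qed
  \<comment> \<open>Translation by \<open>(\<bar>K\<bar>, \<bar>K\<bar>)\<close> makes all coordinates nonnegative.\<close>
  obtain K where K: "\<And>l i. l \<in> L \<Longrightarrow> i \<in> {1..p l} \<Longrightarrow> \<bar>X0 l i\<bar> + \<bar>Y0 l i\<bar> \<le> K"
    using finite_family_bounded[of "SIGMA l:L. {1..p l}" "\<lambda>(l, i). \<bar>X0 l i\<bar> + \<bar>Y0 l i\<bar>"] fin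
    by fastforce
  define T where "T l = N * p l * (e l)\<^sup>2 + (p l + q l) * \<bar>K\<bar>" for l
  show thesis
  proof (rule that[of "2 * \<bar>K\<bar>" "\<lambda>l i. X0 l i + \<bar>K\<bar>" "\<lambda>l i. Y0 l i + \<bar>K\<bar>" T])
    fix l i assume l: "l \<in> L" "i \<in> {1..p l}"
    show "X0 l i + \<bar>K\<bar> \<in> {0..2 * \<bar>K\<bar>} \<and> Y0 l i + \<bar>K\<bar> \<in> {0..2 * \<bar>K\<bar>}"
      using K[OF l] by auto
    show "p l * (X0 l i + \<bar>K\<bar>) + q l * (Y0 l i + \<bar>K\<bar>) = T l + i"
      using gap[OF l(1), of l i] unfolding T_def bez[OF l(1)] by (simp add: algebra_simps)
    fix l' assume l': "l' \<in> L" "l' \<noteq> l"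
    have "N \<ge> 0" using N[OF l(1,1,2)] by linarith
    moreover have "(e l - e l')\<^sup>2 \<ge> 1" 
      using e_inj[OF l(1) l'(1)] l'(2) by (smt (verit) zero_less_power2)
    ultimately have "N * 1 \<le> N * (p l' * (e l - e l')\<^sup>2)"
      using pos[OF l'(1)] mult_mono[of 1 "p l'" 1 "(e l - e l')\<^sup>2"] by (intro mult_left_mono) auto
    then have "p l' * X0 l i + q l' * Y0 l i \<le> N * p l' * (e l')\<^sup>2"
      using gap[OF l'(1), of l i] N[OF l(1) l'(1) l(2)] by (simp add: right_diff_distrib mult.assoc)
    then show "p l' * (X0 l i + \<bar>K\<bar>) + q l' * (Y0 l i + \<bar>K\<bar>) \<le> T l'"
      by (simp add: T_def algebra_simps)
  qed simp
qed

section \<open>Sweeping the box\<close>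

text \<open>Two sweeps fill the box. The first moves a template for the directions with \<open>p l > 0\<close> rightwards along
  the bottom edge. The second moves a template for the directions with \<open>q l > 0\<close> upwards, and it has
  to beat the points of the first sweep. For \<open>p l > 0\<close> this forces its points to run along the right
  edge of the box, for \<open>p l < 0\<close> along the left edge (for \<open>p l = 0\<close> both would do); so the template
  is cut in two. Pulling the two parts apart is harmless: it can only lower the values of the
  points of one part under the functionals of
  the other, relative to their thresholds. A direction with both entries positive takes part in both
  sweeps. All that is lost is a margin \<open>E\<close> independent of \<open>k\<close>.\<close>

lemma large_record_set_in_box:
  fixes p q :: "'l \<Rightarrow> int"
  assumes fin: "finite L" and cop: "\<And>l. l \<in> L \<Longrightarrow> coprime (p l) (q l)"
    and inj: "inj_on (\<lambda>l. (p l, q l)) L"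
  obtains E :: nat where "\<And>k. E \<le> k \<Longrightarrow> \<exists>S \<subseteq> {0..int k} \<times> {0..int k}.
      record_set ((\<lambda>l (x, y). p l * x + q l * y) ` L) S \<and>
      int (card S) = int (k - E) * (sum p {l\<in>L. 0 < p l} + sum q {l\<in>L. 0 < q l})"
proof -
  define Lp where "Lp = {l\<in>L. 0 < p l}"
  define Lq where "Lq = {l\<in>L. 0 < q l}"
  have inj': "inj_on (\<lambda>l. (p l, q l)) Lp" "inj_on (\<lambda>l. (q l, p l)) Lq"
    using inj unfolding inj_on_def Lp_def Lq_def by auto
  obtain X Y T C where t1: "0 \<le> C"
      "\<And>l i. l \<in> Lp \<Longrightarrow> i \<in> {1..p l} \<Longrightarrow> X l i \<in> {0..C} \<and> Y l i \<in> {0..C}"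
      "\<And>l i. l \<in> Lp \<Longrightarrow> i \<in> {1..p l} \<Longrightarrow> p l * X l i + q l * Y l i = T l + i"
      "\<And>l i l'. l \<in> Lp \<Longrightarrow> i \<in> {1..p l} \<Longrightarrow> l' \<in> Lp \<Longrightarrow> l' \<noteq> l \<Longrightarrow>
        p l' * X l i + q l' * Y l i \<le> T l'"
    by (rule polygonal_template[of Lp p q]) (use fin cop inj' in \<open>auto simp: Lp_def\<close>)
  obtain Y' X' T' C' where t2: "0 \<le> C'"
      "\<And>l i. l \<in> Lq \<Longrightarrow> i \<in> {1..q l} \<Longrightarrow> Y' l i \<in> {0..C'} \<and> X' l i \<in> {0..C'}"
      "\<And>l i. l \<in> Lq \<Longrightarrow> i \<in> {1..q l} \<Longrightarrow> q l * Y' l i + p l * X' l i = T' l + i"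
      "\<And>l i l'. l \<in> Lq \<Longrightarrow> i \<in> {1..q l} \<Longrightarrow> l' \<in> Lq \<Longrightarrow> l' \<noteq> l \<Longrightarrow>
        q l' * Y' l i + p l' * X' l i \<le> T' l'"
    by (rule polygonal_template[of Lq q p])
      (use fin cop inj' in \<open>auto simp: Lq_def coprime_commute\<close>)
  obtain R where R: "\<And>l. l \<in> L \<Longrightarrow> \<bar>p l\<bar> \<le> R" "0 \<le> R"
    using finite_family_bounded[OF fin, of p] by (metis abs_ge_zero abs_of_nonneg order_trans linear)
  \<comment> \<open>Each sweep is confined to a strip of width \<open>W\<close> along the edges of the box. Starting the second
    sweep at height \<open>B\<close> outweighs the horizontal error, which is at most \<open>R * W\<close>.\<close>
  define W where "W = C + C'"
  have W: "0 \<le> W" "C \<le> W" "C' \<le> W" using t1(1) t2(1) by (auto simp: W_def)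
  define B where "B = W + R * W + 1"
  have B: "B \<ge> W + 1" using W R(2) by (simp add: B_def)
  define E where "E = nat (B + W)"
  have E: "int E = B + W" using B W by (simp add: E_def)
  define h where "h l = (\<lambda>(x, y). p l * x + q l * y)" for l
  show thesis
  proof (rule that[of E])
    fix k assume k: "E \<le> k"
    define n where "n = k - E"
    have n: "int n = int k - B - W" using k E by (simp add: n_def)
    let ?H = "h ` L"
    define y where "y a l i = (X l i + int a, Y l i)" for a l i
    define shift where "shift l = (if 0 \<le> p l then int n else 0)" for l
    define y' where "y' a l i = (X' l i + shift l, Y' l i + B + int a)" for a l i
    define S where "S = {} \<union> (\<Union>a<n. \<Union>l\<in>Lp. y a l ` {1..p l})"
    define S' where "S' = S \<union> (\<Union>a<n. \<Union>l\<in>Lq. y' a l ` {1..q l})"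
    have S: "record_set ?H S \<and> int (card S) = int (card ({} :: (int \<times> int) set)) + int n * sum p Lp"
      unfolding S_def
    proof (rule record_set_sweep[where h = h and T = T])
      fix l i a assume "l \<in> Lp" "i \<in> {1..p l}"
      from t1(3)[OF this] show "h l (y a l i) = T l + p l * int a + i"
        by (simp add: h_def y_def algebra_simps)
    next
      fix l i l' a assume "l \<in> Lp" "i \<in> {1..p l}" "l' \<in> Lp" "l' \<noteq> l"
      from t1(4)[OF this] show "h l' (y a l i) \<le> T l' + p l' * int a"
        by (simp add: h_def y_def algebra_simps)
    qed (auto simp: Lp_def fin record_set.empty)
    have S_box: "fst s \<in> {0..W + int n} \<and> snd s \<in> {0..W}" if s: "s \<in> S" for s
    proof -
      from s obtain a l i where "a < n" "l \<in> Lp" "i \<in> {1..p l}" "s = y a l i"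
        by (auto simp: S_def)
      then show ?thesis using t1(2)[of l i] W by (auto simp: y_def)
    qed
    have S': "record_set ?H S' \<and> int (card S') = int (card S) + int n * sum q Lq"
      unfolding S'_def
    proof (rule record_set_sweep[where h = h and T = "\<lambda>l. T' l + p l * shift l + q l * B"])
      fix l s assume l: "l \<in> Lq" and s: "s \<in> S"
      have ql: "q l \<ge> 1" "l \<in> L" using l by (auto simp: Lq_def)
      then have "1 \<in> {1..q l}" by simp
      note t = t2(2)[OF l this] t2(3)[OF l this]
      obtain x0 y0 where s0: "s = (x0, y0)" by (cases s)
      have s1: "0 \<le> x0" "x0 \<le> W + int n" "0 \<le> y0" "y0 \<le> W" using S_box[OF s] s0 by auto
      have x: "p l * x0 \<le> p l * (X' l 1 + shift l) + R * W"
      proof (cases "0 \<le> p l")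
        case True
        have "p l * (x0 - (X' l 1 + shift l)) \<le> p l * W"
          using True s1 t by (intro mult_left_mono) (auto simp: shift_def)
        also have "\<dots> \<le> R * W" using R(1)[OF ql(2)] W by (intro mult_right_mono) auto
        finally show ?thesis by (simp add: algebra_simps)
      next
        case False
        have "- p l * (X' l 1 + shift l - x0) \<le> - p l * W"
          using False s1 t W by (intro mult_left_mono) (auto simp: shift_def)
        also have "\<dots> \<le> R * W" using R(1)[OF ql(2)] W by (intro mult_right_mono) auto
        finally show ?thesis by (simp add: algebra_simps)
      qed
      have "1 * (B - W) \<le> q l * (Y' l 1 + B - y0)"
        using ql B s1 t by (intro mult_mono) auto
      then have "q l * y0 + (R * W + 1) \<le> q l * Y' l 1 + q l * B"
        by (simp add: algebra_simps B_def)
      then show "h l s \<le> T' l + p l * shift l + q l * B"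
        using x t(2) by (simp add: h_def s0 algebra_simps)
    next
      fix l i a assume "l \<in> Lq" "i \<in> {1..q l}"
      from t2(3)[OF this] show "h l (y' a l i) = T' l + p l * shift l + q l * B + q l * int a + i"
        by (simp add: h_def y'_def algebra_simps)
    next
      fix l i l' a assume "l \<in> Lq" "i \<in> {1..q l}" "l' \<in> Lq" "l' \<noteq> l"
      from t2(4)[OF this] have "q l' * Y' l i + p l' * X' l i \<le> T' l'" .
      moreover have "p l' * shift l \<le> p l' * shift l'"
        by (auto simp: shift_def mult_nonpos_nonneg)
      ultimately show "h l' (y' a l i) \<le> T' l' + p l' * shift l' + q l' * B + q l' * int a"
        by (simp add: h_def y'_def algebra_simps)
    qed (use S in \<open>auto simp: Lq_def fin\<close>)
    have "S' \<subseteq> {0..int k} \<times> {0..int k}"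
    proof
      fix s assume "s \<in> S'"
      then consider "s \<in> S" | a l i where "a < n" "l \<in> Lq" "i \<in> {1..q l}" "s = y' a l i"
        by (auto simp: S'_def)
      then show "s \<in> {0..int k} \<times> {0..int k}"
      proof cases
        case 1
        then show ?thesis using S_box[OF 1] n B W by (cases s) auto
      next
        case 2
        then show ?thesis using t2(2)[of l i] n B W by (auto simp: y'_def shift_def)
      qed
    qed
    moreover have "int (card S') = int (k - E) * (sum p Lp + sum q Lq)"
      using S S' by (simp add: n_def distrib_left)
    ultimately show "\<exists>S \<subseteq> {0..int k} \<times> {0..int k}.
      record_set ((\<lambda>l (x, y). p l * x + q l * y) ` L) S \<and>
      int (card S) = int (k - E) * (sum p {l\<in>L. 0 < p l} + sum q {l\<in>L. 0 < q l})"
      using S' unfolding h_def Lp_def Lq_def by blast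
  qed
qed

section \<open>Tropical independence\<close>

lemma tropically_independentE:
  assumes "tropically_independent_on V J f"
  obtains b v where "\<And>j. j \<in> J \<Longrightarrow> v j \<in> V"
    and "\<And>i j. i \<in> J \<Longrightarrow> j \<in> J \<Longrightarrow> j \<noteq> i \<Longrightarrow> b i + f i (v i) < b j + f j (v i)"
proof -
  obtain b v where "(\<forall>j\<in>J. v j \<in> V) \<and>
      (\<forall>i\<in>J. \<forall>j\<in>J. j \<noteq> i \<longrightarrow> b i + f i (v i) < b j + f j (v i))"
    using assms unfolding tropically_independent_on_def by (elim exE)
  then show thesis by (intro that[of v b]) simp_all
qed

text \<open>A very large constant term makes the newcomer invisible at the finitely many witness points of the old
  family. In return, its own witness has to be taken where it is smaller than all old functions by a
  large margin.\<close>

lemma tropically_independent_insert: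
  assumes ind: "tropically_independent_on V J f" and fin: "finite J" and x: "x \<notin> J"
    and far: "\<And>B. \<exists>v\<in>V. \<forall>j\<in>J. f x v + B < f j v"
  shows "tropically_independent_on V (insert x J) f"
proof -
  obtain b v where v: "\<And>j. j \<in> J \<Longrightarrow> v j \<in> V"
    and bv: "\<And>j i. j \<in> J \<Longrightarrow> i \<in> J \<Longrightarrow> i \<noteq> j \<Longrightarrow> b j + f j (v j) < b i + f i (v j)"
    by (rule tropically_independentE[OF ind]) (rule that; assumption)
  have bounded: "\<exists>c. \<forall>j\<in>J. g j < c" for g :: "_ \<Rightarrow> real"
  proof -
    have "\<forall>j\<in>J. g j < (\<Sum>j\<in>J. \<bar>g j\<bar>) + 1"
      using member_le_sum[of _ J "\<lambda>j. \<bar>g j\<bar>"] fin by fastforce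
    then show ?thesis by blast
  qed
  obtain c where c: "\<And>j. j \<in> J \<Longrightarrow> b j + f j (v j) - f x (v j) < c"
    using bounded[of "\<lambda>j. b j + f j (v j) - f x (v j)"] by blast
  obtain B where B: "\<And>j. j \<in> J \<Longrightarrow> c - b j < B"
    using bounded[of "\<lambda>j. c - b j"] by blast
  obtain w where w: "w \<in> V" "\<And>j. j \<in> J \<Longrightarrow> f x w + B < f j w"
    using far[of B] by blast
  show ?thesis
    unfolding tropically_independent_on_def
  proof (intro exI[of _ "b(x := c)"] exI[of _ "v(x := w)"] conjI ballI impI)
    fix j assume "j \<in> insert x J"
    then show "(v(x := w)) j \<in> V" using v w by auto
  next
    fix j0 j assume j: "j0 \<in> insert x J" "j \<in> insert x J" "j \<noteq> j0"
    show "(b(x := c)) j0 + f j0 ((v(x := w)) j0) < (b(x := c)) j + f j ((v(x := w)) j0)"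
    proof (cases "j0 = x")
      case True
      then show ?thesis using j B[of j] w(2)[of j] by auto
    next
      case False
      then show ?thesis using j x bv[of j0 j] c[of j0] by auto
    qed
  qed
qed

lemma tropically_independent_inj:
  assumes "tropically_independent_on V J f"
  shows "inj_on f J"
proof (rule inj_onI)
  fix i j assume ij: "i \<in> J" "j \<in> J" "f i = f j"
  obtain b v where bv: "\<And>j i. j \<in> J \<Longrightarrow> i \<in> J \<Longrightarrow> i \<noteq> j \<Longrightarrow> b j + f j (v j) < b i + f i (v j)"
    by (rule tropically_independentE[OF assms]) (rule that)
  show "i = j" using bv[of i j] bv[of j i] ij by fastforce
qed

text \<open>Passes from indexed families to sets of functions, on which the Hilbert function is defined.\<close>

lemma tropically_independent_image:
  assumes "tropically_independent_on V J f"
  shows "tropically_independent_on V (f ` J) (\<lambda>g. g)"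
proof -
  note inj = tropically_independent_inj[OF assms]
  obtain b v where v: "\<And>j. j \<in> J \<Longrightarrow> v j \<in> V"
    and bv: "\<And>j i. j \<in> J \<Longrightarrow> i \<in> J \<Longrightarrow> i \<noteq> j \<Longrightarrow> b j + f j (v j) < b i + f i (v j)"
    by (rule tropically_independentE[OF assms]) (rule that; assumption)
  let ?r = "inv_into J f"
  show ?thesis
    unfolding tropically_independent_on_def
    by (rule exI[of _ "b \<circ> ?r"], rule exI[of _ "v \<circ> ?r"]) (use v bv inj in auto)
qed

lemma record_set_tropically_independent:
  assumes "record_set H S"
    and far: "\<And>h x J B. h \<in> H \<Longrightarrow> finite J \<Longrightarrow> (\<And>s. s \<in> J \<Longrightarrow> h s < h x) \<Longrightarrow>
      \<exists>v\<in>V. \<forall>s\<in>J. f x v + B < f s v"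
  shows "tropically_independent_on V S f"
  using assms(1)
proof (induction rule: record_set.induct)
  case empty
  then show ?case by (simp add: tropically_independent_on_def)
next
  case (insert S h x)
  have "finite S" using insert.hyps(1) by (rule record_set_finite)
  moreover have "x \<notin> S" using insert.hyps(3)[of x] by blast
  ultimately show ?case
    using tropically_independent_insert[OF insert.IH] far[OF insert.hyps(2) _ insert.hyps(3)]
    by blast
qed

lemma card_le_TH_box:
  assumes "S \<subseteq> box_monomials k" "tropically_independent_on V S (\<lambda>f. f)"
  shows "card S \<le> TH_box V k"
  unfolding TH_box_def using assms by (intro Max_ge TH_box_candidates) auto

lemma TH_box_attained:
  obtains S where "S \<subseteq> box_monomials k" "tropically_independent_on V S (\<lambda>f. f)" "card S = TH_box V k"
  using Max_in[OF TH_box_candidates[of k V]] unfolding TH_box_def by auto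

lemma trop_monomial_plane: "trop_monomial i (x :: real^2) = of_int (i 1) * x $ 1 + of_int (i 2) * x $ 2"
  by (simp add: trop_monomial_def sum_2)

lemma trop_monomial_on_ray:
  "trop_monomial i (v0 + z *\<^sub>R vector [of_int p, of_int q] :: real^2) =
    trop_monomial i v0 + z * of_int (i 1 * p + i 2 * q)"
  by (simp add: trop_monomial_plane algebra_simps)

lemma sum_sign_split:
  fixes p :: "'l \<Rightarrow> int"
  assumes "finite L"
  shows "sum p L = sum p {l\<in>L. 0 < p l} + sum p {l\<in>L. p l < 0}"
    "(\<Sum>l\<in>L. max 0 (- p l)) = - sum p {l\<in>L. p l < 0}"
proof -
  have "sum p L = (\<Sum>l\<in>L. (if 0 < p l then p l else 0) + (if p l < 0 then p l else 0))"
    by (intro sum.cong) auto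
  then show "sum p L = sum p {l\<in>L. 0 < p l} + sum p {l\<in>L. p l < 0}"
    using assms by (simp add: sum.distrib sum.inter_filter)
  have "(\<Sum>l\<in>L. max 0 (- p l)) = (\<Sum>l\<in>L. - (if p l < 0 then p l else 0))"
    by (intro sum.cong) auto
  then show "(\<Sum>l\<in>L. max 0 (- p l)) = - sum p {l\<in>L. p l < 0}"
    using assms by (simp add: sum_negf sum.inter_filter)
qed

text \<open>The left-hand side is the affine interpolation, between \<open>x = 0\<close> and \<open>x = k\<close>, of \<open>k\<close> times the
  negative and \<open>k\<close> times the positive part of the sum.\<close>

lemma coordinate_slope_sum_le:
  fixes p :: "'l \<Rightarrow> int"
  assumes "finite L" "0 \<le> x" "x \<le> int k"
  shows "(\<Sum>l\<in>L. x * p l + int k * max 0 (- p l)) \<le>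
    int k * max (sum p {l\<in>L. 0 < p l}) (- sum p {l\<in>L. p l < 0})"
proof -
  define P N where "P = sum p {l\<in>L. 0 < p l}" and "N = - sum p {l\<in>L. p l < 0}"
  have "(\<Sum>l\<in>L. x * p l + int k * max 0 (- p l)) = x * P + (int k - x) * N"
    using sum_sign_split[OF assms(1), of p]
    by (simp add: sum.distrib sum_distrib_left[symmetric] P_def N_def algebra_simps)
  also have "\<dots> \<le> x * max P N + (int k - x) * max P N"
    using assms by (intro add_mono mult_left_mono) auto
  finally show ?thesis unfolding P_def N_def by (simp add: algebra_simps)
qed

section \<open>The upper bound on a star\<close>

text \<open>On a ray with direction \<open>(p l, q l)\<close> two monomials of equal slope cannot both have a strict minimum, and
  the monomial \<open>a\<close> that is minimal at the apex is nowhere on the ray above a monomial of larger slope.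
  So the monomials with witness on that ray have distinct slopes between the least slope in the box and
  the slope of \<open>a\<close>. The point is that the same \<open>a\<close> serves all rays: the sum over the rays is an
  affine function of the exponents of \<open>a\<close>, and it is maximal at a corner of the box.\<close>

lemma TH_box_star_le:
  fixes V :: "(real^2) set" and p q :: "'l \<Rightarrow> int"
  assumes V: "V = (\<Union>l\<in>L. ray v0 (p l) (q l))" and fin: "finite L"
  shows "int (TH_box V k) \<le>
    int k * (max (sum p {l\<in>L. 0 < p l}) (- sum p {l\<in>L. p l < 0}) +
      max (sum q {l\<in>L. 0 < q l}) (- sum q {l\<in>L. q l < 0})) + int (card L)"
    (is "_ \<le> int k * (?P + ?Q) + _")
proof -
  obtain S where S: "S \<subseteq> box_monomials k" "tropically_independent_on V S (\<lambda>f. f)" "card S = TH_box V k"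
    by (rule TH_box_attained)
  have finS: "finite S" using S(1) finite_box_monomials finite_subset by blast
  show ?thesis
  proof (cases "S = {}")
    case True
    have "0 \<le> ?P" "0 \<le> ?Q" by (auto simp: le_max_iff_disj intro!: disjI1 sum_nonneg)
    then show ?thesis using True S(3) by simp
  next
    case False
    obtain b v where v: "\<And>f. f \<in> S \<Longrightarrow> v f \<in> V"
      and bv: "\<And>f g. f \<in> S \<Longrightarrow> g \<in> S \<Longrightarrow> g \<noteq> f \<Longrightarrow> b f + f (v f) < b g + g (v f)"
      by (rule tropically_independentE[OF S(2)]) (rule that; assumption)
    have "\<forall>f\<in>S. \<exists>c. f = trop_monomial c \<and> (\<forall>j. 0 \<le> c j \<and> c j \<le> int k)"
      using S(1) by (auto simp: box_monomials_def)
    then obtain c where "\<forall>f\<in>S. f = trop_monomial (c f) \<and> (\<forall>j. 0 \<le> c f j \<and> c f j \<le> int k)"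
      by (rule bchoice[THEN exE])
    then have c: "\<And>f. f \<in> S \<Longrightarrow> f = trop_monomial (c f)"
      "\<And>f j. f \<in> S \<Longrightarrow> 0 \<le> c f j \<and> c f j \<le> int k"
      by blast+
    have "\<forall>f\<in>S. \<exists>l\<in>L. v f \<in> ray v0 (p l) (q l)"
      using v V by blast
    then obtain l where l: "\<forall>f\<in>S. l f \<in> L \<and> v f \<in> ray v0 (p (l f)) (q (l f))"
      unfolding Bex_def by (rule bchoice[THEN exE])
    then have "\<forall>f\<in>S. \<exists>z\<ge>0. v f = v0 + z *\<^sub>R vector [of_int (p (l f)), of_int (q (l f))]"
      by (auto simp: ray_def)
    then obtain z where "\<forall>f\<in>S. 0 \<le> z f \<and>
        v f = v0 + z f *\<^sub>R vector [of_int (p (l f)), of_int (q (l f))]"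
      by (rule bchoice[THEN exE])
    with l have lz: "\<And>f. f \<in> S \<Longrightarrow> l f \<in> L" "\<And>f. f \<in> S \<Longrightarrow> (0::real) \<le> z f"
      "\<And>f. f \<in> S \<Longrightarrow> v f = v0 + z f *\<^sub>R vector [of_int (p (l f)), of_int (q (l f))]"
      by blast+
    define s where "s f l = c f 1 * p l + c f 2 * q l" for f l
    have val: "g (v f) = g v0 + z f * of_int (s g (l f))" if "f \<in> S" "g \<in> S" for f g
      using trop_monomial_on_ray[of "c g" v0 "z f" "p (l f)" "q (l f)"]
      unfolding s_def lz(3)[OF that(1)] c(1)[OF that(2), symmetric] .
    obtain a where a: "a \<in> S" "\<And>f. f \<in> S \<Longrightarrow> b a + a v0 \<le> b f + f v0"
      using arg_min_if_finite[OF finS False, of "\<lambda>f. b f + f v0"] by (meson not_less)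
    define m where "m l = int k * max 0 (- p l) + int k * max 0 (- q l)" for l
    have s_ge: "- m l \<le> s f l" if "f \<in> S" for f l
    proof -
      have *: "- (int k * max 0 (- r)) \<le> x * r" if "0 \<le> x" "x \<le> int k" for x r :: int
        using that mult_right_mono_neg[of x "int k" r] by (cases "0 \<le> r") (auto simp: max_def)
      show ?thesis using *[of "c f 1" "p l"] *[of "c f 2" "q l"] c(2)[OF that]
        by (simp add: m_def s_def)
    qed
    have s_le: "s f (l f) \<le> s a (l f)" if f: "f \<in> S" for f
    proof (rule ccontr)
      assume "\<not> s f (l f) \<le> s a (l f)"
      then have "a \<noteq> f" and "z f * of_int (s a (l f)) \<le> z f * of_int (s f (l f))"
        using lz(2)[OF f] by (auto intro!: mult_left_mono)
      then show False
        using bv[OF f a(1) \<open>a \<noteq> f\<close>] a(2)[OF f] val[OF f f] val[OF f a(1)] by linarith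
    qed
    have card_l: "int (card {f\<in>S. l f = i}) \<le> s a i + m i + 1" for i
    proof -
      have "inj_on (\<lambda>f. s f i) {f\<in>S. l f = i}"
      proof (rule inj_onI, rule ccontr)
        fix f g assume f: "f \<in> {f\<in>S. l f = i}" and g: "g \<in> {f\<in>S. l f = i}"
          and eq: "s f i = s g i" and ne: "f \<noteq> g"
        have *: "f \<in> S" "g \<in> S" "l f = i" "l g = i" using f g by auto
        show False
          using bv[OF *(1,2) ne[symmetric]] bv[OF *(2,1) ne]
            val[OF *(1,1)] val[OF *(1,2)] val[OF *(2,1)] val[OF *(2,2)]
          unfolding *(3,4) eq by linarith
      qed
      moreover have "(\<lambda>f. s f i) ` {f\<in>S. l f = i} \<subseteq> {- m i..s a i}"
      proof (rule image_subsetI)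
        fix f assume "f \<in> {f\<in>S. l f = i}"
        then show "s f i \<in> {- m i..s a i}" using s_le[of f] s_ge[of f i] by simp
      qed
      ultimately have "card {f\<in>S. l f = i} \<le> card {- m i..s a i}"
        by (intro card_inj_on_le) simp_all
      then show ?thesis using s_ge[OF a(1), of i] by simp
    qed
    have "S \<subseteq> (\<Union>i\<in>L. {f\<in>S. l f = i})" using lz(1) by blast
    then have "card S \<le> card (\<Union>i\<in>L. {f\<in>S. l f = i})"
      using fin finS by (intro card_mono) simp_all
    also have "\<dots> \<le> (\<Sum>i\<in>L. card {f\<in>S. l f = i})" using fin by (rule card_UN_le)
    finally have "int (card S) \<le> int (\<Sum>i\<in>L. card {f\<in>S. l f = i})" by (rule of_nat_mono)
    also have "\<dots> = (\<Sum>i\<in>L. int (card {f\<in>S. l f = i}))" by (rule of_nat_sum)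
    also have "\<dots> \<le> (\<Sum>i\<in>L. s a i + m i + 1)" using card_l by (rule sum_mono)
    also have "\<dots> = (\<Sum>l\<in>L. c a 1 * p l + int k * max 0 (- p l)) +
        (\<Sum>l\<in>L. c a 2 * q l + int k * max 0 (- q l)) + int (card L)"
      by (simp add: s_def m_def sum.distrib)
    also have "\<dots> \<le> int k * ?P + int k * ?Q + int (card L)"
      using c(2)[OF a(1)] fin by (intro add_mono coordinate_slope_sum_le order_refl) auto
    finally show ?thesis using S(3) by (simp add: distrib_left)
  qed
qed

section \<open>The lower bound on a star\<close>

text \<open>The corner of the box at which the upper bound is attained is moved to the origin by reflecting the two
  exponents, which flips the signs of \<open>p\<close> and \<open>q\<close> accordingly; then a large record set for the negated
  slopes yields independent monomials.\<close>

lemma TH_box_star_ge: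
  fixes V :: "(real^2) set" and p q :: "'l \<Rightarrow> int"
  assumes V: "V = (\<Union>l\<in>L. ray v0 (p l) (q l))" and fin: "finite L"
    and cop: "\<And>l. l \<in> L \<Longrightarrow> coprime (p l) (q l)" and inj: "inj_on (\<lambda>l. (p l, q l)) L"
  obtains E :: nat where "\<And>k. E \<le> k \<Longrightarrow>
    int (k - E) * (max (sum p {l\<in>L. 0 < p l}) (- sum p {l\<in>L. p l < 0}) +
      max (sum q {l\<in>L. 0 < q l}) (- sum q {l\<in>L. q l < 0})) \<le> int (TH_box V k)"
proof -
  have sign: "\<exists>\<sigma>\<in>{1, -1}. max (sum r {l\<in>L. 0 < r l}) (- sum r {l\<in>L. r l < 0}) =
      sum (\<lambda>l. \<sigma> * r l) {l\<in>L. 0 < \<sigma> * r l}" for r :: "'l \<Rightarrow> int"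
    by (cases "sum r {l\<in>L. 0 < r l} \<ge> - sum r {l\<in>L. r l < 0}") (auto simp: max_def sum_negf)
  obtain \<sigma> where \<sigma>: "\<sigma> \<in> {1, -1}" "max (sum p {l\<in>L. 0 < p l}) (- sum p {l\<in>L. p l < 0}) =
      sum (\<lambda>l. \<sigma> * p l) {l\<in>L. 0 < \<sigma> * p l}" using sign[of p] by blast
  obtain \<tau> where \<tau>: "\<tau> \<in> {1, -1}" "max (sum q {l\<in>L. 0 < q l}) (- sum q {l\<in>L. q l < 0}) =
      sum (\<lambda>l. \<tau> * q l) {l\<in>L. 0 < \<tau> * q l}" using sign[of q] by blast
  have "coprime (\<sigma> * p l) (\<tau> * q l)" if "l \<in> L" for l
    using \<sigma>(1) \<tau>(1) cop[OF that] by auto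
  moreover have "inj_on (\<lambda>l. (\<sigma> * p l, \<tau> * q l)) L"
    using inj \<sigma>(1) \<tau>(1) by (auto simp: inj_on_def)
  ultimately obtain E where E: "\<And>k. E \<le> k \<Longrightarrow> \<exists>S \<subseteq> {0..int k} \<times> {0..int k}.
      record_set ((\<lambda>l (x, y). (\<sigma> * p l) * x + (\<tau> * q l) * y) ` L) S \<and>
      int (card S) = int (k - E) * (sum (\<lambda>l. \<sigma> * p l) {l\<in>L. 0 < \<sigma> * p l} +
        sum (\<lambda>l. \<tau> * q l) {l\<in>L. 0 < \<tau> * q l})"
    using large_record_set_in_box[OF fin, of "\<lambda>l. \<sigma> * p l" "\<lambda>l. \<tau> * q l"] by blast
  show thesis
  proof (rule that[of E])
    fix k assume "E \<le> k"
    from E[OF this] obtain S where S: "S \<subseteq> {0..int k} \<times> {0..int k}"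
      "record_set ((\<lambda>l (x, y). (\<sigma> * p l) * x + (\<tau> * q l) * y) ` L) S"
      "int (card S) = int (k - E) * (sum (\<lambda>l. \<sigma> * p l) {l\<in>L. 0 < \<sigma> * p l} +
        sum (\<lambda>l. \<tau> * q l) {l\<in>L. 0 < \<tau> * q l})" by blast
    \<comment> \<open>The functionals of the record set are to be the negated slopes, up to a constant on each ray.
      Hence a coordinate is reflected precisely when its sign is positive.\<close>
    define flip where "flip \<epsilon> x = (if \<epsilon> = 1 then int k - x else x)" for \<epsilon> x :: int
    define f :: "int \<times> int \<Rightarrow> real^2 \<Rightarrow> real" where
      "f m = trop_monomial (\<lambda>j. if j = 1 then flip \<sigma> (fst m) else flip \<tau> (snd m))" for m
    have ind: "tropically_independent_on V S f"
      using S(2)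
    proof (rule record_set_tropically_independent)
      fix h x and J :: "(int \<times> int) set" and B :: real
      assume h: "h \<in> (\<lambda>l (x, y). (\<sigma> * p l) * x + (\<tau> * q l) * y) ` L"
        and J: "finite J" "\<And>s. s \<in> J \<Longrightarrow> h s < h x"
      from h obtain l where l: "l \<in> L" and h_eq: "h = (\<lambda>(x, y). (\<sigma> * p l) * x + (\<tau> * q l) * y)"
        by blast
      \<comment> \<open>The slopes are integers, so at distance \<open>z\<close> the newcomer gains at least \<open>z\<close>; this has to pay for
        \<open>B\<close> and for the differences of the values at the apex.\<close>
      define z where "z = \<bar>B\<bar> + 1 + (\<Sum>s\<in>J. \<bar>f x v0 - f s v0\<bar>)"
      define v where "v = v0 + z *\<^sub>R (vector [of_int (p l), of_int (q l)] :: real^2)"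
      have z: "0 \<le> z" by (simp add: z_def sum_nonneg)
      then have "v \<in> V" using V l by (auto simp: ray_def v_def)
      moreover have "f x v + B < f s v" if s: "s \<in> J" for s
      proof -
        have "f s v - f x v = f s v0 - f x v0 + z * of_int (h x - h s)"
          using \<sigma>(1) \<tau>(1) unfolding f_def v_def trop_monomial_on_ray h_eq
          by (auto simp: flip_def case_prod_beta algebra_simps)
        moreover have "z * 1 \<le> z * of_int (h x - h s)"
          using J(2)[OF s] z by (intro mult_left_mono) linarith+
        moreover have "\<bar>f x v0 - f s v0\<bar> \<le> (\<Sum>s\<in>J. \<bar>f x v0 - f s v0\<bar>)"
          using J(1) s by (intro member_le_sum) auto
        ultimately show ?thesis using z_def by linarith
      qed
      ultimately show "\<exists>v\<in>V. \<forall>s\<in>J. f x v + B < f s v" by blast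
    qed
    have "f ` S \<subseteq> box_monomials k"
    proof
      fix g assume "g \<in> f ` S"
      then obtain m where m: "m \<in> S" "g = f m" by blast
      have "0 \<le> flip \<sigma> (fst m) \<and> flip \<sigma> (fst m) \<le> int k"
        "0 \<le> flip \<tau> (snd m) \<and> flip \<tau> (snd m) \<le> int k"
        using m(1) S(1) by (auto simp: flip_def)
      then show "g \<in> box_monomials k"
        unfolding box_monomials_def m(2) f_def 
        by (intro CollectI exI[of _ "\<lambda>j. if j = 1 then flip \<sigma> (fst m) else flip \<tau> (snd m)"]) auto
    qed
    from card_le_TH_box[OF this tropically_independent_image[OF ind]]
    have "card S \<le> TH_box V k"
      by (simp add: card_image[OF tropically_independent_inj[OF ind]])
    then show "int (k - E) * (max (sum p {l\<in>L. 0 < p l}) (- sum p {l\<in>L. p l < 0}) +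
      max (sum q {l\<in>L. 0 < q l}) (- sum q {l\<in>L. q l < 0})) \<le> int (TH_box V k)"
      using S(3) \<sigma>(2) \<tau>(2) by simp
  qed
qed

section \<open>The degree of a star\<close>

lemma ratio_tendsto_if_bounded_error:
  fixes f :: "nat \<Rightarrow> nat" and d :: int
  assumes lower: "\<And>k. E \<le> k \<Longrightarrow> int (k - E) * d \<le> int (f k)"
    and upper: "\<And>k. int (f k) \<le> int k * d + int c"
  shows "(\<lambda>k. real (f k) / real k) \<longlonglongrightarrow> real_of_int d"
proof (rule tendsto_sandwich)
  show "(\<lambda>k. real_of_int d - real E * real_of_int d / real k) \<longlonglongrightarrow> real_of_int d"
    using tendsto_diff[OF tendsto_const[of "real_of_int d"] lim_const_over_n[of "real E * real_of_int d"]]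
    by simp
  show "(\<lambda>k. real_of_int d + real c / real k) \<longlonglongrightarrow> real_of_int d"
    using tendsto_add[OF tendsto_const[of "real_of_int d"] lim_const_over_n[of "real c"]] by simp
  show "\<forall>\<^sub>F k in sequentially. real_of_int d - real E * real_of_int d / real k \<le> real (f k) / real k"
    using eventually_ge_at_top[of "E + 1"]
  proof eventually_elim
    case (elim k)
    have "real_of_int (int (k - E) * d) \<le> real_of_int (int (f k))"
      using lower[of k] elim by (simp only: of_int_le_iff)
    then have "(real k - real E) * real_of_int d \<le> real (f k)"
      using elim by simp
    from divide_right_mono[OF this, of "real k"] show ?case
      using elim by (simp add: diff_divide_distrib left_diff_distrib)
  qed
  show "\<forall>\<^sub>F k in sequentially. real (f k) / real k \<le> real_of_int d + real c / real k"
    using eventually_ge_at_top[of 1]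
  proof eventually_elim
    case (elim k)
    have "real_of_int (int (f k)) \<le> real_of_int (int k * d + int c)"
      using upper[of k] by (simp only: of_int_le_iff)
    then show ?case using elim by (simp add: field_simps)
  qed
qed

theorem theorem4p2:
  fixes V :: "(real^2) set" and v0 :: "real^2" and M :: nat and p q :: "nat \<Rightarrow> int"
  assumes star: "V = (\<Union>l\<in>{1..M}. ray v0 (p l) (q l))"
    and distinct_rays: "inj_on (\<lambda>l. ray v0 (p l) (q l)) {1..M}"
    and primitive: "\<And>l. l \<in> {1..M} \<Longrightarrow>
      coprime (p l) (q l) \<or> (p l * q l = 0 \<and> \<bar>p l\<bar> + \<bar>q l\<bar> = 1)"
  shows "convergent (\<lambda>k. real (TH_box V k) / real k) \<and>
    degT_box V = real_of_int
      (max (\<Sum>l\<in>{l\<in>{1..M}. p l > 0}. p l) (- (\<Sum>l\<in>{l\<in>{1..M}. p l < 0}. p l)) +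
       max (\<Sum>l\<in>{l\<in>{1..M}. q l > 0}. q l) (- (\<Sum>l\<in>{l\<in>{1..M}. q l < 0}. q l)))"
    (is "_ \<and> _ = real_of_int ?D")
proof -
  have cop: "coprime (p l) (q l)" if "l \<in> {1..M}" for l
  proof (cases "p l = 0")
    case True
    then show ?thesis using primitive[OF that] by auto
  next
    case False
    then show ?thesis using primitive[OF that] by (cases "q l = 0") auto
  qed
  have inj: "inj_on (\<lambda>l. (p l, q l)) {1..M}"
  proof (rule inj_onI)
    fix l l' assume "l \<in> {1..M}" "l' \<in> {1..M}" "(p l, q l) = (p l', q l')"
    then show "l = l'" using inj_onD[OF distinct_rays, of l l'] by simp
  qed
  obtain E where E: "\<And>k. E \<le> k \<Longrightarrow> int (k - E) * ?D \<le> int (TH_box V k)"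
    using TH_box_star_ge[OF star finite_atLeastAtMost cop inj] by blast
  moreover have "int (TH_box V k) \<le> int k * ?D + int M" for k
    using TH_box_star_le[OF star finite_atLeastAtMost, of k] by simp
  ultimately have "(\<lambda>k. real (TH_box V k) / real k) \<longlonglongrightarrow> real_of_int ?D"
    by (rule ratio_tendsto_if_bounded_error)
  then show ?thesis
    unfolding degT_box_def by (auto simp: convergent_def limI)
qed

end
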